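(* Let $X\subseteq\mathbb{C}^n$ be an algebraic variety, let $S\subseteq X$ be a Zariski-dense subset, and let $T_qX$ denote the tangent space of $X$ at $q$. Then $$\mathfrak{g}_X=\{A\in\mathfrak{gl}_n(\mathbb{C}) \mid A.q\in T_qX \text{ for all } q\in S\}.$$
   Context: $G_X=\{g\in\mathrm{GL}_n(\mathbb{C})\mid gX=X\}$ is the symmetry group of $X$, a Zariski closed subgroup of $\mathrm{GL}_n(\mathbb{C})$, and $\mathfrak{g}_X\subseteq\mathfrak{gl}_n(\mathbb{C})$ is its Lie algebra (the symmetry Lie algebra of $X$). $A.q$ is the matrix-vector product. $T_qX\subseteq\mathbb{C}^n$ is the Zariski tangent space, i.e. the linear subspace of $v\in\mathbb{C}^n$ such that for every $f$ in the vanishing ideal $I(X)$ one has $f(q+\varepsilon v)=0 \bmod \varepsilon^2$. *)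

theory Defs
  imports "HOL-Analysis.Analysis" "HOL-Library.Poly_Mapping" "HOL-Computational_Algebra.Polynomial"
begin

text \<open>Polynomials with variables indexed by \<open>'i\<close>: a finitely supported map from
  monomials (exponent vectors) to coefficients.\<close>

type_synonym ('i, 'a) mpoly = "('i \<Rightarrow>\<^sub>0 nat) \<Rightarrow>\<^sub>0 'a"

text \<open>Evaluation at a point with coordinates in an algebra \<open>'b\<close> over the coefficient ring,
  \<open>h\<close> being the structure map.\<close>

definition mpoly_eval ::
    "('a::zero \<Rightarrow> 'b::comm_semiring_1) \<Rightarrow> ('i::finite, 'a) mpoly \<Rightarrow> ('i \<Rightarrow> 'b) \<Rightarrow> 'b" where
  "mpoly_eval h f x =
     (\<Sum>m\<in>Poly_Mapping.keys f. h (Poly_Mapping.lookup f m) * (\<Prod>i\<in>UNIV. x i ^ Poly_Mapping.lookup m i))"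

definition zero_locus :: "('i::finite, complex) mpoly set \<Rightarrow> (complex ^ 'i) set" where
  "zero_locus F = {x. \<forall>f\<in>F. mpoly_eval id f (\<lambda>i. x $ i) = 0}"

definition vanishing_ideal :: "(complex ^ 'i::finite) set \<Rightarrow> ('i, complex) mpoly set" where
  "vanishing_ideal X = {f. \<forall>x\<in>X. mpoly_eval id f (\<lambda>i. x $ i) = 0}"

text \<open>Closed subvarieties of affine space; irreducibility is not required.\<close>

definition zariski_closed :: "(complex ^ 'i::finite) set \<Rightarrow> bool" where
  "zariski_closed X \<longleftrightarrow> (\<exists>F. X = zero_locus F)"

definition zariski_closure :: "(complex ^ 'i::finite) set \<Rightarrow> (complex ^ 'i) set" where
  "zariski_closure S = \<Inter>{Z. zariski_closed Z \<and> S \<subseteq> Z}"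

definition zariski_dense_in :: "(complex ^ 'i::finite) set \<Rightarrow> (complex ^ 'i) set \<Rightarrow> bool" where
  "zariski_dense_in S X \<longleftrightarrow> S \<subseteq> X \<and> X \<subseteq> zariski_closure S"

text \<open>The condition \<open>f (q + \<epsilon> v) = 0 mod \<epsilon>\<^sup>2\<close>, read in the univariate polynomial ring in
  \<open>\<epsilon>\<close>: \<open>[:q $ i, v $ i:]\<close> is \<open>q\<^sub>i + \<epsilon> v\<^sub>i\<close> and \<open>[:0, 0, 1:]\<close> is \<open>\<epsilon>\<^sup>2\<close>.\<close>

definition tangent_space :: "(complex ^ 'i::finite) set \<Rightarrow> complex ^ 'i \<Rightarrow> (complex ^ 'i) set" where
  "tangent_space X q =
     {v. \<forall>f\<in>vanishing_ideal X. [:0, 0, 1:] dvd mpoly_eval (\<lambda>c. [:c:]) f (\<lambda>i. [:q $ i, v $ i:])}"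

definition symmetry_group :: "(complex ^ 'n::finite) set \<Rightarrow> (complex ^ 'n ^ 'n) set" where
  "symmetry_group X = {g. invertible g \<and> (\<lambda>x. g *v x) ` X = X}"

definition vec_of_matrix :: "complex ^ 'n ^ 'n \<Rightarrow> complex ^ ('n::finite \<times> 'n)" where
  "vec_of_matrix M = (\<chi> p. M $ fst p $ snd p)"

text \<open>The Lie algebra, as a set of matrices, of a Zariski closed subgroup \<open>G\<close> of the general
  linear group: the Zariski tangent space of \<open>G\<close> at the identity. The regular functions on the
  general linear group are \<open>f / det ^ k\<close> with \<open>f\<close> a polynomial in the matrix entries; since
  \<open>det\<close> is invertible at the identity, allowing these denominators would give the same tangent
  space as the polynomials in the entries alone.\<close>

definition lie_algebra :: "(complex ^ 'n ^ 'n) set \<Rightarrow> (complex ^ 'n::finite ^ 'n) set" where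
  "lie_algebra G = {A. vec_of_matrix A \<in> tangent_space (vec_of_matrix ` G) (vec_of_matrix (mat 1))}"

definition symmetry_lie_algebra :: "(complex ^ 'n::finite) set \<Rightarrow> (complex ^ 'n ^ 'n) set" where
  "symmetry_lie_algebra X = lie_algebra (symmetry_group X)"

end

theory Submission
  imports Defs "HOL-Complex_Analysis.Cauchy_Integral_Formula"
begin

text \<open>
  A vector \<open>v\<close> is tangent to \<open>X\<close> at \<open>q\<close> iff every polynomial function \<open>f\<close> vanishing on \<open>X\<close>
  satisfies \<open>f q = 0\<close> and has derivative \<open>0\<close> along the line \<open>t \<mapsto> q + t v\<close>
  (\<open>tangent_space_iff\<close>). By the chain rule the line may be replaced by any curve with the same
  velocity, so both inclusions become statements about derivatives along curves.

  If \<open>A\<close> is in the Lie algebra, \<open>f\<close> vanishes on \<open>X\<close> and \<open>q \<in> X\<close>, then \<open>g \<mapsto> f (g q)\<close> is a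
  polynomial in the entries of \<open>g\<close> that vanishes on the symmetry group. Its derivative at the
  identity in direction \<open>A\<close>, which is the derivative of \<open>f\<close> at \<open>q\<close> in direction \<open>A q\<close>,
  is therefore \<open>0\<close>.

  Conversely, suppose \<open>A q\<close> is tangent to \<open>X\<close> at \<open>q\<close> for all \<open>q \<in> S\<close>. The derivation
  \<open>(D f) x = df\<^sub>x (A x)\<close> maps polynomials to polynomials. If \<open>f\<close> vanishes on \<open>X\<close>, then \<open>D f\<close>
  vanishes on \<open>S\<close> and hence, by density, on \<open>X\<close>: the ideal of \<open>X\<close> is stable under \<open>D\<close>. For
  \<open>q \<in> X\<close> the \<open>k\<close>-th derivative of the entire function \<open>t \<mapsto> f (exp (t A) q)\<close> is
  \<open>(D\<^sup>k f) (exp (t A) q)\<close>, which is \<open>0\<close> at \<open>t = 0\<close> for all \<open>k\<close>; so the function is identically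
  \<open>0\<close> (\<open>vanishes_along_flow\<close>). Thus \<open>exp (t A)\<close> maps \<open>X\<close> into \<open>X\<close>, and so does its inverse
  \<open>exp (- t A)\<close>, so \<open>exp (t A)\<close> lies in the symmetry group. The velocity of this curve at the
  identity is \<open>A\<close>, so \<open>A\<close> is in the Lie algebra.
\<close>

section \<open>Polynomial functions\<close>

text \<open>The inductive form gives closure under composition and differentiation by rule induction;
  \<open>polyfun_iff_mpoly_eval\<close> identifies these functions with the evaluations of polynomials.\<close>

inductive polyfun :: "(complex ^ 'i::finite \<Rightarrow> complex) \<Rightarrow> bool" where
  const: "polyfun (\<lambda>x. c)"
| coord: "polyfun (\<lambda>x. x $ i)"
| add: "polyfun f \<Longrightarrow> polyfun g \<Longrightarrow> polyfun (\<lambda>x. f x + g x)"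
| mult: "polyfun f \<Longrightarrow> polyfun g \<Longrightarrow> polyfun (\<lambda>x. f x * g x)"

lemma polyfun_sum:
  assumes "\<And>a. a \<in> I \<Longrightarrow> polyfun (f a)"
  shows "polyfun (\<lambda>x. \<Sum>a\<in>I. f a x)"
  using assms by (induction I rule: infinite_finite_induct) (auto intro: polyfun.intros)

lemma polyfun_prod:
  assumes "\<And>a. a \<in> I \<Longrightarrow> polyfun (f a)"
  shows "polyfun (\<lambda>x. \<Prod>a\<in>I. f a x)"
  using assms by (induction I rule: infinite_finite_induct) (auto intro: polyfun.intros)

lemma polyfun_power: "polyfun f \<Longrightarrow> polyfun (\<lambda>x. f x ^ n)"
  by (induction n) (auto intro: polyfun.intros)

lemma polyfun_compose:
  assumes "polyfun f" and "\<And>i. polyfun (\<lambda>y. g y $ i)"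
  shows "polyfun (\<lambda>y. f (g y))"
  using assms by induction (auto intro: polyfun.intros)

lemma polyfun_matrix_vector: "polyfun (\<lambda>x. (A *v x) $ i)"
  unfolding matrix_vector_mult_def by (auto intro!: polyfun_sum polyfun.intros)

lemma mpoly_eval_superset:
  assumes "finite M" and "Poly_Mapping.keys f \<subseteq> M"
  shows "mpoly_eval id f x =
    (\<Sum>m\<in>M. Poly_Mapping.lookup f m * (\<Prod>i\<in>UNIV. x i ^ Poly_Mapping.lookup m i))"
  unfolding mpoly_eval_def
  by (rule sum.mono_neutral_cong_left) (use assms in \<open>auto simp: in_keys_iff\<close>)

lemma mpoly_eval_add:
  fixes f g :: "('i::finite, 'a::comm_semiring_1) mpoly"
  shows "mpoly_eval id (f + g) x = mpoly_eval id f x + mpoly_eval id g x"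
proof -
  let ?M = "Poly_Mapping.keys f \<union> Poly_Mapping.keys g"
  have "Poly_Mapping.keys (f + g) \<subseteq> ?M"
    by (rule Poly_Mapping.keys_add)
  then show ?thesis
    by (simp add: mpoly_eval_superset[of ?M] lookup_add distrib_right sum.distrib)
qed

lemma mpoly_eval_sum:
  fixes f :: "'b \<Rightarrow> ('i::finite, 'a::comm_semiring_1) mpoly"
  assumes "finite I"
  shows "mpoly_eval id (\<Sum>a\<in>I. f a) x = (\<Sum>a\<in>I. mpoly_eval id (f a) x)"
  using assms
proof induction
  case empty
  show ?case by (simp add: mpoly_eval_def)
next
  case (insert a I)
  show ?case
    unfolding sum.insert[OF insert.hyps] mpoly_eval_add insert.IH ..
qed

lemma mpoly_eval_single:
  "mpoly_eval id (Poly_Mapping.single m c) x = c * (\<Prod>i\<in>UNIV. x i ^ Poly_Mapping.lookup m i)"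
  by (simp add: mpoly_eval_superset[of "{m}"])

text \<open>Distributing the product over the two expansions leaves a sum of monomials, each obtained
  by adding exponent vectors.\<close>

lemma mpoly_eval_mult_ex:
  fixes f g :: "('i::finite, 'a::comm_semiring_1) mpoly"
  shows "\<exists>h. \<forall>x. mpoly_eval id h x = mpoly_eval id f x * mpoly_eval id g x"
proof -
  define h where "h = (\<Sum>m\<in>Poly_Mapping.keys f. \<Sum>n\<in>Poly_Mapping.keys g.
    Poly_Mapping.single (m + n) (Poly_Mapping.lookup f m * Poly_Mapping.lookup g n))"
  have "mpoly_eval id h x = mpoly_eval id f x * mpoly_eval id g x" for x
    unfolding h_def
    by (simp add: mpoly_eval_sum mpoly_eval_single mpoly_eval_def[of id f] mpoly_eval_def[of id g]
        sum_product lookup_add power_add prod.distrib mult_ac)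
  then show ?thesis by blast
qed

lemma polyfun_mpoly_eval: "polyfun (\<lambda>x. mpoly_eval id f (\<lambda>i. x $ i))"
  unfolding mpoly_eval_def
  by (intro polyfun_sum polyfun.mult polyfun_prod polyfun_power polyfun.const polyfun.coord)

lemma polyfun_iff_mpoly_eval:
  fixes p :: "complex ^ 'i::finite \<Rightarrow> complex"
  shows "polyfun p \<longleftrightarrow> (\<exists>f. p = (\<lambda>x. mpoly_eval id f (\<lambda>i. x $ i)))"
proof
  assume "polyfun p"
  then show "\<exists>f. p = (\<lambda>x. mpoly_eval id f (\<lambda>i. x $ i))"
  proof induction
    case (const c)
    have "(\<lambda>x. c) = (\<lambda>x::complex ^ 'i. mpoly_eval id (Poly_Mapping.single 0 c) (\<lambda>i. x $ i))"
      by (simp add: mpoly_eval_single)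
    then show ?case by blast
  next
    case (coord j)
    have "(\<Prod>i\<in>UNIV. x $ i ^ Poly_Mapping.lookup (Poly_Mapping.single j 1) i) = x $ j"
      for x :: "complex ^ 'i"
    proof -
      have "(\<Prod>i\<in>UNIV. x $ i ^ Poly_Mapping.lookup (Poly_Mapping.single j 1) i) =
          (\<Prod>i\<in>UNIV. if i = j then x $ i else 1)"
        by (rule prod.cong) (auto simp: lookup_single when_def)
      then show ?thesis by simp
    qed
    then have "(\<lambda>x::complex ^ 'i. x $ j) = (\<lambda>x.
        mpoly_eval id (Poly_Mapping.single (Poly_Mapping.single j 1) 1) (\<lambda>i. x $ i))"
      by (simp add: mpoly_eval_single)
    then show ?case by blast
  next
    case (add f g)
    then obtain a b where "f = (\<lambda>x. mpoly_eval id a (\<lambda>i. x $ i))"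
      and "g = (\<lambda>x. mpoly_eval id b (\<lambda>i. x $ i))" by blast
    then have "(\<lambda>x. f x + g x) = (\<lambda>x. mpoly_eval id (a + b) (\<lambda>i. x $ i))"
      by (simp only: mpoly_eval_add)
    then show ?case by blast
  next
    case (mult f g)
    then obtain a b where "f = (\<lambda>x. mpoly_eval id a (\<lambda>i. x $ i))"
      and "g = (\<lambda>x. mpoly_eval id b (\<lambda>i. x $ i))" by blast
    moreover obtain h where "\<forall>x. mpoly_eval id h x = mpoly_eval id a x * mpoly_eval id b x"
      using mpoly_eval_mult_ex by blast
    ultimately have "(\<lambda>x. f x * g x) = (\<lambda>x. mpoly_eval id h (\<lambda>i. x $ i))" by simp
    then show ?case by blast
  qed
qed (auto intro: polyfun_mpoly_eval)

text \<open>The witnesses \<open>p'\<close> are the partial derivatives; the chain rule is built in so that it can be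
  used along lines and along the exponential curve alike.\<close>

lemma polyfun_gradient:
  fixes p :: "complex ^ 'i::finite \<Rightarrow> complex"
  assumes "polyfun p"
  shows "\<exists>p'. (\<forall>i. polyfun (p' i)) \<and>
    (\<forall>\<gamma> v t. (\<forall>i. ((\<lambda>s. \<gamma> s $ i) has_field_derivative v $ i) (at t)) \<longrightarrow>
      ((\<lambda>s. p (\<gamma> s)) has_field_derivative (\<Sum>i\<in>UNIV. p' i (\<gamma> t) * v $ i)) (at t))"
  using assms
proof induction
  case (const c)
  show ?case
    by (rule exI[of _ "\<lambda>i x. 0"]) (auto intro: polyfun.intros)
next
  case (coord j)
  have "(\<Sum>i\<in>UNIV. (if i = j then 1 else 0) * v $ i) = v $ j" for v :: "complex ^ 'i"
    by (simp add: if_distrib[of "\<lambda>c. c * _"] cong: if_cong)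
  then show ?case
    by (intro exI[of _ "\<lambda>i x. if i = j then 1 else 0"]) (auto intro: polyfun.intros)
next
  case (add f g)
  then obtain f' g' where f': "\<forall>i. polyfun (f' i)" "\<forall>\<gamma> v t.
      (\<forall>i. ((\<lambda>s. \<gamma> s $ i) has_field_derivative v $ i) (at t)) \<longrightarrow>
        ((\<lambda>s. f (\<gamma> s)) has_field_derivative (\<Sum>i\<in>UNIV. f' i (\<gamma> t) * v $ i)) (at t)"
    and g': "\<forall>i. polyfun (g' i)" "\<forall>\<gamma> v t.
      (\<forall>i. ((\<lambda>s. \<gamma> s $ i) has_field_derivative v $ i) (at t)) \<longrightarrow>
        ((\<lambda>s. g (\<gamma> s)) has_field_derivative (\<Sum>i\<in>UNIV. g' i (\<gamma> t) * v $ i)) (at t)"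
    by blast
  show ?case
  proof (intro exI[of _ "\<lambda>i x. f' i x + g' i x"] conjI allI impI)
    show "polyfun (\<lambda>x. f' i x + g' i x)" for i
      using f' g' by (auto intro: polyfun.intros)
  next
    fix \<gamma> :: "complex \<Rightarrow> complex ^ 'i" and v t
    assume "\<forall>i. ((\<lambda>s. \<gamma> s $ i) has_field_derivative v $ i) (at t)"
    then show "((\<lambda>s. f (\<gamma> s) + g (\<gamma> s)) has_field_derivative
        (\<Sum>i\<in>UNIV. (f' i (\<gamma> t) + g' i (\<gamma> t)) * v $ i)) (at t)"
      using f' g' by (simp add: distrib_right sum.distrib DERIV_add)
  qed
next
  case (mult f g)
  then obtain f' g' where f': "\<forall>i. polyfun (f' i)" "\<forall>\<gamma> v t.
      (\<forall>i. ((\<lambda>s. \<gamma> s $ i) has_field_derivative v $ i) (at t)) \<longrightarrow>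
        ((\<lambda>s. f (\<gamma> s)) has_field_derivative (\<Sum>i\<in>UNIV. f' i (\<gamma> t) * v $ i)) (at t)"
    and g': "\<forall>i. polyfun (g' i)" "\<forall>\<gamma> v t.
      (\<forall>i. ((\<lambda>s. \<gamma> s $ i) has_field_derivative v $ i) (at t)) \<longrightarrow>
        ((\<lambda>s. g (\<gamma> s)) has_field_derivative (\<Sum>i\<in>UNIV. g' i (\<gamma> t) * v $ i)) (at t)"
    by blast
  show ?case
  proof (intro exI[of _ "\<lambda>i x. f' i x * g x + g' i x * f x"] conjI allI impI)
    show "polyfun (\<lambda>x. f' i x * g x + g' i x * f x)" for i
      by (intro polyfun.add polyfun.mult) (use f' g' mult.hyps in auto)
  next
    fix \<gamma> :: "complex \<Rightarrow> complex ^ 'i" and v t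
    assume *: "\<forall>i. ((\<lambda>s. \<gamma> s $ i) has_field_derivative v $ i) (at t)"
    have "((\<lambda>s. f (\<gamma> s) * g (\<gamma> s)) has_field_derivative
        (\<Sum>i\<in>UNIV. f' i (\<gamma> t) * v $ i) * g (\<gamma> t) + (\<Sum>i\<in>UNIV. g' i (\<gamma> t) * v $ i) * f (\<gamma> t))
        (at t)"
      by (intro DERIV_mult) (use f' g' * in auto)
    then show "((\<lambda>s. f (\<gamma> s) * g (\<gamma> s)) has_field_derivative
        (\<Sum>i\<in>UNIV. (f' i (\<gamma> t) * g (\<gamma> t) + g' i (\<gamma> t) * f (\<gamma> t)) * v $ i)) (at t)"
      by (simp add: sum_distrib_left sum_distrib_right sum.distrib algebra_simps)
  qed
qed

section \<open>Tangent spaces and density in terms of polynomial functions\<close>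

text \<open>Substituting a number \<open>t\<close> for \<open>\<epsilon>\<close> is a ring homomorphism, so it commutes with evaluating
  \<open>f\<close>.\<close>

lemma poly_mpoly_eval_line:
  "poly (mpoly_eval (\<lambda>c. [:c:]) f (\<lambda>i. [:q $ i, v $ i:])) t =
    mpoly_eval id f (\<lambda>i. (q + t *s v) $ i)"
  by (simp add: mpoly_eval_def poly_sum poly_prod)

lemma square_dvd_iff_value_and_derivative:
  fixes P :: "complex poly"
  shows "[:0, 0, 1:] dvd P \<longleftrightarrow> poly P 0 = 0 \<and> (poly P has_field_derivative 0) (at 0)"
proof -
  have "[:0, 0, 1:] = monom (1::complex) 2"
    by (simp add: numeral_2_eq_2 monom_Suc)
  then have "[:0, 0, 1:] dvd P \<longleftrightarrow> coeff P 0 = 0 \<and> coeff P 1 = 0"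
    by (simp add: monom_1_dvd_iff' numeral_2_eq_2 less_Suc_eq all_conj_distrib)
  also have "coeff P 0 = poly P 0"
    by (simp add: poly_0_coeff_0)
  also have "coeff P 1 = poly (pderiv P) 0"
    by (simp add: poly_0_coeff_0 coeff_pderiv)
  also have "poly (pderiv P) 0 = 0 \<longleftrightarrow> (poly P has_field_derivative 0) (at 0)"
    using poly_DERIV[of P 0] DERIV_unique by metis
  finally show ?thesis .
qed

text \<open>The coefficients of \<open>f (q + \<epsilon> v)\<close> at \<open>\<epsilon>\<^sup>0\<close> and \<open>\<epsilon>\<^sup>1\<close> are the value and the first derivative
  at \<open>0\<close>, so tangency no longer mentions formal polynomials.\<close>

lemma tangent_space_iff:
  fixes X :: "(complex ^ 'i::finite) set"
  shows "v \<in> tangent_space X q \<longleftrightarrow>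
    (\<forall>p. polyfun p \<longrightarrow> (\<forall>x\<in>X. p x = 0) \<longrightarrow>
      p q = 0 \<and> ((\<lambda>t. p (q + t *s v)) has_field_derivative 0) (at 0))"
proof -
  \<comment> \<open>Writing \<open>q\<close> as \<open>q + 0 v\<close> puts both conditions in the form that \<open>poly_line\<close> produces.\<close>
  define Q where "Q p \<longleftrightarrow> (\<forall>x\<in>X. p x = 0) \<longrightarrow>
      p (q + 0 *s v) = 0 \<and> ((\<lambda>t. p (q + t *s v)) has_field_derivative 0) (at 0)" for p
  have poly_line: "poly (mpoly_eval (\<lambda>c. [:c:]) f (\<lambda>i. [:q $ i, v $ i:])) =
      (\<lambda>t. mpoly_eval id f (\<lambda>i. (q + t *s v) $ i))" for f
    by (rule ext) (rule poly_mpoly_eval_line)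
  have "v \<in> tangent_space X q \<longleftrightarrow> (\<forall>f. Q (\<lambda>x. mpoly_eval id f (\<lambda>i. x $ i)))"
    unfolding tangent_space_def vanishing_ideal_def Q_def mem_Collect_eq Ball_def
      square_dvd_iff_value_and_derivative poly_line by blast
  also have "\<dots> \<longleftrightarrow> (\<forall>p. polyfun p \<longrightarrow> Q p)"
    by (auto simp: polyfun_iff_mpoly_eval)
  finally show ?thesis
    by (simp add: Q_def)
qed

lemma polyfun_vanishes_by_density:
  assumes "zariski_dense_in S X" and "polyfun p" and "\<And>q. q \<in> S \<Longrightarrow> p q = 0" and "x \<in> X"
  shows "p x = 0"
proof -
  obtain f where p: "p = (\<lambda>x. mpoly_eval id f (\<lambda>i. x $ i))"
    using assms(2) polyfun_iff_mpoly_eval by blast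
  have "zariski_closed (zero_locus {f})"
    unfolding zariski_closed_def by blast
  moreover have "S \<subseteq> zero_locus {f}"
    using assms(3) by (auto simp: p zero_locus_def)
  ultimately have "x \<in> zero_locus {f}"
    using assms(1,4) unfolding zariski_dense_in_def zariski_closure_def by blast
  then show ?thesis
    by (simp add: p zero_locus_def)
qed

lemma zariski_closed_memI:
  assumes "zariski_closed X"
    and "\<And>p. polyfun p \<Longrightarrow> (\<And>y. y \<in> X \<Longrightarrow> p y = 0) \<Longrightarrow> p x = 0"
  shows "x \<in> X"
proof -
  obtain F where "X = zero_locus F"
    using assms(1) zariski_closed_def by blast
  then show ?thesis
    using assms(2)[OF polyfun_mpoly_eval] by (auto simp: zero_locus_def)
qed

section \<open>The exponential of a complex matrix\<close>

primrec matrix_power :: "complex ^ 'n ^ 'n \<Rightarrow> nat \<Rightarrow> complex ^ 'n ^ 'n::finite" where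
  "matrix_power A 0 = mat 1"
| "matrix_power A (Suc k) = A ** matrix_power A k"

lemma matrix_power_Suc_right: "matrix_power A (Suc k) = matrix_power A k ** A"
  by (induction k) (simp_all add: matrix_mul_assoc)

text \<open>The sum of the moduli of all entries is a submultiplicative norm that dominates every entry;
  this crude bound suffices for the exponential series to converge.\<close>

lemma norm_matrix_power_entry_le:
  fixes A :: "complex ^ 'n::finite ^ 'n"
  shows "norm (matrix_power A k $ i $ j) \<le> (\<Sum>i\<in>UNIV. \<Sum>j\<in>UNIV. norm (A $ i $ j)) ^ k"
proof (induction k arbitrary: i j)
  case 0
  then show ?case by (simp add: mat_def)
next
  case (Suc k)
  let ?C = "\<Sum>i\<in>UNIV. \<Sum>j\<in>UNIV. norm (A $ i $ j)"
  have "norm (matrix_power A (Suc k) $ i $ j) \<le>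
      (\<Sum>l\<in>UNIV. norm (A $ i $ l * matrix_power A k $ l $ j))"
    by (simp add: matrix_matrix_mult_def norm_sum)
  also have "\<dots> \<le> (\<Sum>l\<in>UNIV. norm (A $ i $ l) * ?C ^ k)"
    using Suc by (intro sum_mono) (simp add: norm_mult mult_left_mono)
  also have "\<dots> = (\<Sum>l\<in>UNIV. norm (A $ i $ l)) * ?C ^ k"
    by (simp add: sum_distrib_right)
  also have "\<dots> \<le> ?C * ?C ^ k"
    by (intro mult_right_mono member_le_sum zero_le_power sum_nonneg) auto
  finally show ?case by simp
qed

text \<open>The exponential is built entrywise from scalar power series, so that it can be
  differentiated term by term in \<open>t\<close>.\<close>

definition exp_entry_coeff :: "complex ^ 'n::finite ^ 'n \<Rightarrow> 'n \<Rightarrow> 'n \<Rightarrow> nat \<Rightarrow> complex" where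
  "exp_entry_coeff A i j k = matrix_power A k $ i $ j / fact k"

definition matrix_exp :: "complex ^ 'n::finite ^ 'n \<Rightarrow> complex \<Rightarrow> complex ^ 'n ^ 'n" where
  "matrix_exp A t = (\<chi> i j. suminf (\<lambda>k. exp_entry_coeff A i j k * t ^ k))"

lemma summable_exp_entry: "summable (\<lambda>k. exp_entry_coeff A i j k * t ^ k)"
proof (rule summable_comparison_test)
  let ?C = "\<Sum>i\<in>UNIV. \<Sum>j\<in>UNIV. norm (A $ i $ j)"
  show "summable (\<lambda>k. inverse (fact k) * (?C * norm t) ^ k)"
    by (rule summable_exp)
  show "\<exists>N. \<forall>k\<ge>N. norm (exp_entry_coeff A i j k * t ^ k) \<le> inverse (fact k) * (?C * norm t) ^ k"
    using mult_right_mono[OF norm_matrix_power_entry_le[of A _ i j], of "norm t ^ _ / fact _"]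
    by (auto simp: exp_entry_coeff_def norm_mult norm_divide norm_power power_mult_distrib
        field_simps)
qed

lemma matrix_exp_0: "matrix_exp A 0 = mat 1"
  by (simp add: matrix_exp_def vec_eq_iff powser_zero) (simp add: exp_entry_coeff_def)

lemma diffs_exp_entry_coeff:
  "diffs (exp_entry_coeff A i j) = (\<lambda>k. matrix_power A (Suc k) $ i $ j / fact k)"
  by (rule ext) (simp add: diffs_def exp_entry_coeff_def field_simps del: matrix_power.simps
      of_nat_Suc)

lemma matrix_exp_entry_derivative:
  "((\<lambda>t. matrix_exp A t $ i $ j) has_field_derivative
    suminf (\<lambda>k. matrix_power A (Suc k) $ i $ j / fact k * t ^ k)) (at t)"
  using termdiffs_strong_converges_everywhere[OF summable_exp_entry, of A i j t]
  by (simp add: matrix_exp_def diffs_exp_entry_coeff)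

text \<open>The two forms of the derivative come from \<open>A\<^sup>k\<^sup>+\<^sup>1 = A A\<^sup>k = A\<^sup>k A\<close>.\<close>

lemma matrix_exp_derivative_left:
  "((\<lambda>t. matrix_exp A t $ i $ j) has_field_derivative (A ** matrix_exp A t) $ i $ j) (at t)"
proof -
  have "(A ** matrix_exp A t) $ i $ j =
      (\<Sum>l\<in>UNIV. suminf (\<lambda>k. A $ i $ l * (exp_entry_coeff A l j k * t ^ k)))"
    by (simp add: matrix_matrix_mult_def matrix_exp_def suminf_mult summable_exp_entry)
  also have "\<dots> = suminf (\<lambda>k. \<Sum>l\<in>UNIV. A $ i $ l * (exp_entry_coeff A l j k * t ^ k))"
    by (rule suminf_sum[symmetric]) (simp add: summable_mult summable_exp_entry)
  also have "\<dots> = suminf (\<lambda>k. matrix_power A (Suc k) $ i $ j / fact k * t ^ k)"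
    by (simp add: matrix_matrix_mult_def exp_entry_coeff_def sum_distrib_left sum_divide_distrib
        mult_ac)
  finally show ?thesis
    using matrix_exp_entry_derivative[of A i j t] by simp
qed

lemma matrix_exp_derivative_right:
  "((\<lambda>t. matrix_exp A t $ i $ j) has_field_derivative (matrix_exp A t ** A) $ i $ j) (at t)"
proof -
  have "(matrix_exp A t ** A) $ i $ j =
      (\<Sum>l\<in>UNIV. suminf (\<lambda>k. exp_entry_coeff A i l k * t ^ k * A $ l $ j))"
    by (simp add: matrix_matrix_mult_def matrix_exp_def suminf_mult2 summable_exp_entry)
  also have "\<dots> = suminf (\<lambda>k. \<Sum>l\<in>UNIV. exp_entry_coeff A i l k * t ^ k * A $ l $ j)"
    by (rule suminf_sum[symmetric]) (simp add: summable_mult2 summable_exp_entry)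
  also have "\<dots> = suminf (\<lambda>k. matrix_power A (Suc k) $ i $ j / fact k * t ^ k)"
    unfolding matrix_power_Suc_right
    by (simp add: matrix_matrix_mult_def exp_entry_coeff_def sum_distrib_left sum_divide_distrib
        mult_ac)
  finally show ?thesis
    using matrix_exp_entry_derivative[of A i j t] by simp
qed

text \<open>In the derivative of \<open>exp (- t A) exp (t A)\<close> the two terms cancel once \<open>A\<close> is written
  between the factors, so the product keeps its value at \<open>t = 0\<close>.\<close>

lemma matrix_exp_minus_mult: "matrix_exp A (- t) ** matrix_exp A t = mat 1"
proof -
  have neg: "((\<lambda>t. matrix_exp A (- t) $ i $ l) has_field_derivative
      - ((matrix_exp A (- t) ** A) $ i $ l)) (at t)" for i l t
    using DERIV_chain2[OF matrix_exp_derivative_right DERIV_minus[OF DERIV_ident]] by simp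
  have "((\<lambda>t. (matrix_exp A (- t) ** matrix_exp A t) $ i $ j) has_field_derivative 0) (at t)"
    for i j t
  proof -
    have "((\<lambda>t. \<Sum>l\<in>UNIV. matrix_exp A (- t) $ i $ l * matrix_exp A t $ l $ j)
        has_field_derivative
        (\<Sum>l\<in>UNIV. - ((matrix_exp A (- t) ** A) $ i $ l) * matrix_exp A t $ l $ j +
          (A ** matrix_exp A t) $ l $ j * matrix_exp A (- t) $ i $ l)) (at t)"
      by (intro DERIV_sum DERIV_mult neg matrix_exp_derivative_left)
    moreover have "(\<Sum>l\<in>UNIV. - ((matrix_exp A (- t) ** A) $ i $ l) * matrix_exp A t $ l $ j +
          (A ** matrix_exp A t) $ l $ j * matrix_exp A (- t) $ i $ l) =
        (matrix_exp A (- t) ** (A ** matrix_exp A t)) $ i $ j -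
        ((matrix_exp A (- t) ** A) ** matrix_exp A t) $ i $ j"
      unfolding matrix_matrix_mult_def[of _ "A ** matrix_exp A t"]
        matrix_matrix_mult_def[of "matrix_exp A (- t) ** A"]
      by (simp add: sum_subtractf mult.commute)
    ultimately show ?thesis
      by (simp add: matrix_mul_assoc) (simp add: matrix_matrix_mult_def)
  qed
  then have "(matrix_exp A (- t) ** matrix_exp A t) $ i $ j =
      (matrix_exp A (- 0) ** matrix_exp A 0) $ i $ j" for i j
    using has_field_derivative_zero_constant[of UNIV
        "\<lambda>t. (matrix_exp A (- t) ** matrix_exp A t) $ i $ j"] by (metis UNIV_I convex_UNIV)
  then show ?thesis
    by (simp add: vec_eq_iff matrix_exp_0)
qed

section \<open>Infinitesimal symmetries integrate to symmetries\<close>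

lemma flow_derivative:
  fixes A :: "complex ^ 'n::finite ^ 'n"
  shows "((\<lambda>t. (matrix_exp A t *v q) $ i) has_field_derivative
    (A *v (matrix_exp A t *v q)) $ i) (at t)"
proof -
  have coord: "(M *v q) $ i = (\<Sum>j\<in>UNIV. M $ i $ j * q $ j)" for M :: "complex ^ 'n ^ 'n"
    by (simp add: matrix_vector_mult_def)
  show ?thesis
    unfolding matrix_vector_mul_assoc coord
    by (intro DERIV_sum DERIV_cmult_right matrix_exp_derivative_left)
qed

text \<open>The function \<open>p'\<close> is the derivation \<open>x \<mapsto> dp\<^sub>x (A x)\<close> applied to \<open>p\<close>; it vanishes on \<open>X\<close>
  because it vanishes on the dense set \<open>S\<close>.\<close>

lemma derivation_preserves_vanishing:
  fixes X S :: "(complex ^ 'n::finite) set"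
  assumes dense: "zariski_dense_in S X"
    and tangent: "\<forall>q\<in>S. A *v q \<in> tangent_space X q"
    and p: "polyfun p" "\<forall>x\<in>X. p x = 0"
  shows "\<exists>p'. polyfun p' \<and> (\<forall>x\<in>X. p' x = 0) \<and>
    (\<forall>q t. ((\<lambda>t. p (matrix_exp A t *v q)) has_field_derivative
      p' (matrix_exp A t *v q)) (at t))"
proof -
  obtain d where d: "\<forall>i. polyfun (d i)"
    and chain: "\<forall>\<gamma> v t. (\<forall>i. ((\<lambda>s. \<gamma> s $ i) has_field_derivative v $ i) (at t)) \<longrightarrow>
      ((\<lambda>s. p (\<gamma> s)) has_field_derivative (\<Sum>i\<in>UNIV. d i (\<gamma> t) * v $ i)) (at t)"
    using polyfun_gradient[OF p(1)] by blast
  define p' where "p' = (\<lambda>x. \<Sum>i\<in>UNIV. d i x * (A *v x) $ i)"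
  have polyfun_p': "polyfun p'"
    unfolding p'_def by (intro polyfun_sum polyfun.mult d[rule_format] polyfun_matrix_vector)
  have "p' q = 0" if "q \<in> S" for q
  proof -
    have "((\<lambda>t. p (q + t *s (A *v q))) has_field_derivative
        (\<Sum>i\<in>UNIV. d i (q + 0 *s (A *v q)) * (A *v q) $ i)) (at 0)"
      by (rule chain[rule_format]) (auto intro!: derivative_eq_intros)
    moreover have "((\<lambda>t. p (q + t *s (A *v q))) has_field_derivative 0) (at 0)"
      using tangent that p by (simp add: tangent_space_iff)
    ultimately show ?thesis
      using DERIV_unique by (fastforce simp: p'_def)
  qed
  then have "p' x = 0" if "x \<in> X" for x
    using polyfun_vanishes_by_density[OF dense polyfun_p'] that by blast
  moreover have "((\<lambda>t. p (matrix_exp A t *v q)) has_field_derivative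
      p' (matrix_exp A t *v q)) (at t)" for q t
    unfolding p'_def by (rule chain[rule_format]) (rule flow_derivative)
  ultimately show ?thesis
    using polyfun_p' by blast
qed

text \<open>The function \<open>t \<mapsto> p (exp (t A) q)\<close> is entire, and iterating the derivation shows that all
  its derivatives vanish at \<open>0\<close>.\<close>

lemma vanishes_along_flow:
  fixes X S :: "(complex ^ 'n::finite) set"
  assumes dense: "zariski_dense_in S X"
    and tangent: "\<forall>q\<in>S. A *v q \<in> tangent_space X q"
    and p: "polyfun p" "\<forall>x\<in>X. p x = 0" and "q \<in> X"
  shows "p (matrix_exp A t *v q) = 0"
proof -
  \<comment> \<open>The ideal of \<open>X\<close>, on which a choice of the derivation is iterated.\<close>
  define V where "V = {p. polyfun p \<and> (\<forall>x\<in>X. p x = 0)}"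
  define R where "R p p' \<longleftrightarrow> (\<forall>q t. ((\<lambda>t. p (matrix_exp A t *v q)) has_field_derivative
      p' (matrix_exp A t *v q)) (at t))" for p p' :: "complex ^ 'n \<Rightarrow> complex"
  have "\<exists>p'. polyfun p' \<and> (\<forall>x\<in>X. p' x = 0) \<and> R p p'" if "p \<in> V" for p
    unfolding R_def
    by (rule derivation_preserves_vanishing[OF dense tangent]) (use that in \<open>auto simp: V_def\<close>)
  then have "\<forall>p\<in>V. \<exists>p'. p' \<in> V \<and> R p p'"
    by (simp add: V_def)
  from bchoice[OF this] obtain D where D_R: "\<forall>p\<in>V. D p \<in> V \<and> R p (D p)"
    by blast
  then have D_mem: "D p \<in> V" if "p \<in> V" for p
    using that by simp
  have D: "((\<lambda>t. p (matrix_exp A t *v q)) has_field_derivative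
      D p (matrix_exp A t *v q)) (at t)" if "p \<in> V" for p q t
    using D_R that by (simp add: R_def)
  have iter_mem: "(D ^^ k) p \<in> V" for k
  proof (induction k)
    case 0
    show ?case using p by (simp add: V_def)
  qed (simp add: D_mem)
  have iter_deriv: "(deriv ^^ k) (\<lambda>t. p (matrix_exp A t *v q)) =
      (\<lambda>t. (D ^^ k) p (matrix_exp A t *v q))" for k
  proof (induction k)
    case (Suc k)
    have "deriv (\<lambda>t. (D ^^ k) p (matrix_exp A t *v q)) =
        (\<lambda>t. D ((D ^^ k) p) (matrix_exp A t *v q))"
      by (rule ext) (rule DERIV_imp_deriv[OF D[OF iter_mem]])
    then show ?case
      unfolding funpow.simps o_apply Suc.IH .
  qed simp
  have "(\<lambda>t. (D ^^ 0) p (matrix_exp A t *v q)) holomorphic_on UNIV"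
    unfolding holomorphic_on_open[OF open_UNIV] by (intro ballI exI) (rule D[OF iter_mem])
  then have hol: "(\<lambda>t. p (matrix_exp A t *v q)) holomorphic_on UNIV"
    by simp
  have der: "(deriv ^^ k) (\<lambda>t. p (matrix_exp A t *v q)) 0 = 0" for k
  proof -
    have "(D ^^ k) p q = 0"
      using iter_mem[of k] \<open>q \<in> X\<close> unfolding V_def by blast
    then show ?thesis
      unfolding iter_deriv by (simp add: matrix_exp_0)
  qed
  show ?thesis
    by (rule holomorphic_fun_eq_0_on_connected[OF hol open_UNIV connected_UNIV der UNIV_I UNIV_I])
qed

text \<open>Invariance for all \<open>t\<close> is what makes \<open>exp (t A)\<close> surjective on \<open>X\<close>: the preimage of \<open>q\<close> is
  \<open>exp (- t A) q\<close>.\<close>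

lemma matrix_exp_in_symmetry_group:
  fixes X S :: "(complex ^ 'n::finite) set"
  assumes closed: "zariski_closed X" and dense: "zariski_dense_in S X"
    and tangent: "\<forall>q\<in>S. A *v q \<in> tangent_space X q"
  shows "matrix_exp A t \<in> symmetry_group X"
proof -
  have inv: "matrix_exp A (- t) ** matrix_exp A t = mat 1"
      "matrix_exp A t ** matrix_exp A (- t) = mat 1" for t
    using matrix_exp_minus_mult[of A t] matrix_exp_minus_mult[of A "- t"] by simp_all
  have mem: "matrix_exp A t *v q \<in> X" if "q \<in> X" for q t
    by (rule zariski_closed_memI[OF closed])
      (rule vanishes_along_flow[OF dense tangent], use that in auto)
  have "q \<in> (\<lambda>x. matrix_exp A t *v x) ` X" if "q \<in> X" for q
    by (rule image_eqI[OF _ mem[OF that, of "- t"]]) (simp add: matrix_vector_mul_assoc inv)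
  then have "(\<lambda>x. matrix_exp A t *v x) ` X = X"
    using mem by blast
  then show ?thesis
    using inv unfolding symmetry_group_def invertible_def by blast
qed

section \<open>The symmetry Lie algebra\<close>

lemma mat_1_in_symmetry_group: "mat 1 \<in> symmetry_group X"
  by (simp add: symmetry_group_def invertible_def)

text \<open>Pulling back \<open>p\<close> along the orbit map of \<open>q\<close> gives a polynomial that vanishes on the symmetry
  group, and the orbit map sends the line through the identity with velocity \<open>A\<close> to the line
  through \<open>q\<close> with velocity \<open>A q\<close>.\<close>

lemma lie_algebra_imp_tangent:
  fixes X :: "(complex ^ 'n::finite) set"
  assumes A: "A \<in> symmetry_lie_algebra X" and q: "q \<in> X"
  shows "A *v q \<in> tangent_space X q"
  unfolding tangent_space_iff
proof (intro allI impI)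
  fix p :: "complex ^ 'n \<Rightarrow> complex"
  assume p: "polyfun p" "\<forall>x\<in>X. p x = 0"
  \<comment> \<open>The orbit map, extended linearly from the group to all of matrix space.\<close>
  define orbit :: "complex ^ ('n \<times> 'n) \<Rightarrow> complex ^ 'n"
    where "orbit y = (\<chi> i. \<Sum>j\<in>UNIV. y $ (i, j) * q $ j)" for y
  have orbit_matrix: "orbit (vec_of_matrix g) = g *v q" for g
    by (simp add: orbit_def vec_of_matrix_def matrix_vector_mult_def)
  have orbit_line: "orbit (vec_of_matrix (mat 1) + t *s vec_of_matrix A) = q + t *s (A *v q)" for t
  proof -
    have "orbit (vec_of_matrix (mat 1) + t *s vec_of_matrix A) =
        orbit (vec_of_matrix (mat 1)) + t *s orbit (vec_of_matrix A)"
      by (simp add: orbit_def vec_eq_iff distrib_right sum.distrib sum_distrib_left mult.assoc)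
    then show ?thesis by (simp add: orbit_matrix)
  qed
  have "polyfun (\<lambda>y. p (orbit y))"
    using p(1) by (rule polyfun_compose)
      (auto simp: orbit_def intro!: polyfun_sum polyfun.intros)
  moreover have "p (orbit y) = 0" if "y \<in> vec_of_matrix ` symmetry_group X" for y
    using that p(2) q by (auto simp: orbit_matrix symmetry_group_def)
  ultimately have "((\<lambda>t. p (orbit (vec_of_matrix (mat 1) + t *s vec_of_matrix A)))
      has_field_derivative 0) (at 0)"
    using A unfolding symmetry_lie_algebra_def lie_algebra_def tangent_space_iff by blast
  then show "p q = 0 \<and> ((\<lambda>t. p (q + t *s (A *v q))) has_field_derivative 0) (at 0)"
    using p(2) q by (simp add: orbit_line)
qed

text \<open>The line \<open>1 + t A\<close> itself need not stay in the symmetry group, but \<open>exp (t A)\<close> does and has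
  the same velocity at \<open>t = 0\<close>, so by the chain rule \<open>p\<close> has the same derivative along both.\<close>

lemma tangent_imp_lie_algebra:
  fixes X S :: "(complex ^ 'n::finite) set"
  assumes closed: "zariski_closed X" and dense: "zariski_dense_in S X"
    and tangent: "\<forall>q\<in>S. A *v q \<in> tangent_space X q"
  shows "A \<in> symmetry_lie_algebra X"
  unfolding symmetry_lie_algebra_def lie_algebra_def mem_Collect_eq tangent_space_iff
proof (intro allI impI)
  fix p :: "complex ^ ('n \<times> 'n) \<Rightarrow> complex"
  assume p: "polyfun p" "\<forall>y\<in>vec_of_matrix ` symmetry_group X. p y = 0"
  obtain d where
    chain: "\<forall>\<gamma> v t. (\<forall>i. ((\<lambda>s. \<gamma> s $ i) has_field_derivative v $ i) (at t)) \<longrightarrow>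
      ((\<lambda>s. p (\<gamma> s)) has_field_derivative (\<Sum>i\<in>UNIV. d i (\<gamma> t) * v $ i)) (at t)"
    using polyfun_gradient[OF p(1)] by blast
  let ?d = "\<Sum>i\<in>UNIV. d i (vec_of_matrix (mat 1)) * vec_of_matrix A $ i"
  have "((\<lambda>t. p (vec_of_matrix (matrix_exp A t))) has_field_derivative
      (\<Sum>i\<in>UNIV. d i (vec_of_matrix (matrix_exp A 0)) * vec_of_matrix A $ i)) (at 0)"
    using matrix_exp_derivative_left[of A _ _ 0]
    by (intro chain[rule_format]) (simp add: vec_of_matrix_def matrix_exp_0)
  moreover have "(\<lambda>t. p (vec_of_matrix (matrix_exp A t))) = (\<lambda>t. 0)"
    using p(2) matrix_exp_in_symmetry_group[OF closed dense tangent] by blast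
  ultimately have "?d = 0"
    using DERIV_unique[OF _ DERIV_const] by (simp add: matrix_exp_0)
  moreover have "((\<lambda>t. p (vec_of_matrix (mat 1) + t *s vec_of_matrix A)) has_field_derivative
      (\<Sum>i\<in>UNIV. d i (vec_of_matrix (mat 1) + 0 *s vec_of_matrix A) * vec_of_matrix A $ i)) (at 0)"
    by (rule chain[rule_format]) (auto intro!: derivative_eq_intros)
  ultimately show "p (vec_of_matrix (mat 1)) = 0 \<and>
      ((\<lambda>t. p (vec_of_matrix (mat 1) + t *s vec_of_matrix A)) has_field_derivative 0) (at 0)"
    using p(2) mat_1_in_symmetry_group[of X] by simp
qed

theorem theorem2p2:
  fixes X S :: "(complex ^ 'n::finite) set"
  assumes "zariski_closed X"
    and "zariski_dense_in S X"
  shows "symmetry_lie_algebra X = {A :: complex ^ 'n ^ 'n. \<forall>q\<in>S. A *v q \<in> tangent_space X q}"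
proof (intro set_eqI iffI CollectI ballI)
  fix A q assume "A \<in> symmetry_lie_algebra X" and "q \<in> S"
  moreover have "S \<subseteq> X"
    using assms(2) by (simp add: zariski_dense_in_def)
  ultimately show "A *v q \<in> tangent_space X q"
    using lie_algebra_imp_tangent by blast
next
  fix A assume "A \<in> {A :: complex ^ 'n ^ 'n. \<forall>q\<in>S. A *v q \<in> tangent_space X q}"
  then show "A \<in> symmetry_lie_algebra X"
    using tangent_imp_lie_algebra[OF assms] by blast
qed

end
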